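(* Let an obstacle be described by a function $\Upsilon(\bm p;\bm p_o)$, with obstacle area $\mathcal A_o=\{\bm p:\Upsilon(\bm p;\bm p_o)<1\}$ and reactive area $\mathcal A_r=\{\bm p:1\le\Upsilon(\bm p;\bm p_o)\le\bar c\}$, and let the target point of the robot be the origin, with the origin not in $\mathcal A_o\cup\mathcal A_r$. Define the obstacle avoidance vector field in $\mathcal A_r$ by $$\bm F_{OA}=\chi\,\bm F+(1-\chi)\,\bm\tau^b .$$ Then: 1) $\bm F_{OA}$ never penetrates the obstacle area $\mathcal A_o$, i.e. at every point of the obstacle surface $\{\Upsilon(\bm p;\bm p_o)=1\}$ one has $\bm F_{OA}\cdot\bm n=0$, where $\bm n=\nabla_{\bm p}\Upsilon$ is the normal vector; 2) $\bm F_{OA}$ does not vanish at any point of the reactive area $\mathcal A_r$.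
   Context: Setting. $\bm p=(x,y,z)\in\mathbb{R}^3$ is the position variable and $\bm p_o\in\mathbb{R}^3$ is the center of the obstacle. $\Upsilon(\cdot;\bm p_o):\mathbb{R}^3\to\mathbb{R}$ is continuous with continuous first-order derivatives, increases monotonically with respect to $\|\bm p-\bm p_o\|$ (i.e. along rays from $\bm p_o$), and its level surfaces $\Upsilon=\text{const}>0$ enclose a region (example: $\Upsilon=\frac{(x-x_o)^2}{a^2}+\frac{(y-y_o)^2}{b^2}+\frac{(z-z_o)^2}{c^2}$). $\bar c>1$ is a constant, and $\mathcal A_r$ is compact. The obstacle may be static or moving; the statement is pointwise at each time. Vector fields. $\bm F=[x^2-y^2-z^2,\ 2xy,\ 2xz]^{\rm T}$ and $\bm G=[2x(y^2+z^2),\ y(y^2+z^2-x^2),\ z(y^2+z^2-x^2)]^{\rm T}$. The normal vector is $\bm n=\left[\frac{\partial\Upsilon}{\partial x}\ \frac{\partial\Upsilon}{\partial y}\ \frac{\partial\Upsilon}{\partial z}\right]^{\rm T}$. The tangential vector field is $$\bm\tau^b=\begin{cases}(\bm n\times\bm F)\times\bm n, & \text{at points where } \bm n \text{ and } \bm F \text{ are not collinear},\\ \bm G, & \text{at points where } \bm n \text{ and } \bm F\text{ are collinear.}\end{cases}$$ Transition function. $\chi$ is a smooth function of $\bm p$ with $\chi=0$ where $\Upsilon(\bm p;\bm p_o)\le 1$, $\chi=1$ where $\Upsilon(\bm p;\bm p_o)\ge\bar c$, and $\chi=S(\bm p)\in(0,1)$ where $1<\Upsilon(\bm p;\bm p_o)<\bar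 c$.
   Formalization: In part 2, points of the obstacle surface Υ = 1 lying on the x-axis (y = z = 0) at which n and F are collinear are excepted, because there χ = 0 and τ^b = G = 0, so F_OA vanishes (e.g. at the poles of a sphere centred on the x-axis). *)

theory Defs
  imports "HOL-Analysis.Analysis"
begin

unbundle cross3_syntax

definition partial :: "3 \<Rightarrow> (real^3 \<Rightarrow> real) \<Rightarrow> real^3 \<Rightarrow> real" where
  "partial i f p = deriv (\<lambda>t. f (p + t *\<^sub>R axis i 1)) 0"

definition grad :: "(real^3 \<Rightarrow> real) \<Rightarrow> real^3 \<Rightarrow> real^3" where
  "grad f p = vector [partial 1 f p, partial 2 f p, partial 3 f p]"

definition C1 :: "(real^3 \<Rightarrow> real) \<Rightarrow> bool" where
  "C1 f \<longleftrightarrow> f differentiable_on UNIV \<and> continuous_on UNIV (grad f)"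

text \<open>C-infinity: every iterated partial derivative is (totally) differentiable, hence continuous.\<close>
definition smooth :: "(real^3 \<Rightarrow> real) \<Rightarrow> bool" where
  "smooth f \<longleftrightarrow> (\<forall>is. foldr partial is f differentiable_on UNIV)"

definition F :: "real^3 \<Rightarrow> real^3" where
  "F p = (let x = p$1; y = p$2; z = p$3 in vector [x^2 - y^2 - z^2, 2*x*y, 2*x*z])"

definition G :: "real^3 \<Rightarrow> real^3" where
  "G p = (let x = p$1; y = p$2; z = p$3 in
     vector [2*x*(y^2 + z^2), y*(y^2 + z^2 - x^2), z*(y^2 + z^2 - x^2)])"

text \<open>Two vectors are collinear iff their end points and the origin lie on a line; in particular
  the zero vector is collinear with every vector.\<close>
definition tangential :: "(real^3 \<Rightarrow> real) \<Rightarrow> real^3 \<Rightarrow> real^3" where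
  "tangential \<Upsilon> p = (let n = grad \<Upsilon> p in
     if collinear {0, n, F p} then G p else (n \<times> F p) \<times> n)"

definition obstacle_area :: "(real^3 \<Rightarrow> real) \<Rightarrow> (real^3) set" where
  "obstacle_area \<Upsilon> = {p. \<Upsilon> p < 1}"

definition reactive_area :: "(real^3 \<Rightarrow> real) \<Rightarrow> real \<Rightarrow> (real^3) set" where
  "reactive_area \<Upsilon> c = {p. 1 \<le> \<Upsilon> p \<and> \<Upsilon> p \<le> c}"

definition F_OA :: "(real^3 \<Rightarrow> real) \<Rightarrow> (real^3 \<Rightarrow> real) \<Rightarrow> real^3 \<Rightarrow> real^3" where
  "F_OA \<Upsilon> \<psi> p = \<psi> p *\<^sub>R F p + (1 - \<psi> p) *\<^sub>R tangential \<Upsilon> p"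

text \<open>The field G is zero on the x-axis. So F_OA does vanish where the obstacle surface
  (on which the transition function is zero) meets the x-axis with the normal collinear to F, for
  instance at both poles of a sphere centred on the x-axis.\<close>
lemma F_OA_eq_0_on_axis:
  assumes "\<psi> p = 0" "p$2 = 0" "p$3 = 0" "collinear {0, grad \<Upsilon> p, F p}"
  shows "F_OA \<Upsilon> \<psi> p = 0"
proof -
  have "G p = 0"
    using assms by (simp add: G_def Let_def vec_eq_iff forall_3)
  then show ?thesis
    using assms by (simp add: F_OA_def tangential_def)
qed

end

theory Submission
  imports Defs
begin

text \<open>The fields F and G are everywhere orthogonal. Off the origin F is nonzero, so a normal n
  collinear with F is a multiple of F and hence orthogonal to G. For the second claim, test F_OA
  against F: the part of the tangential field along F is nonnegative, so the product is positive
  wherever the transition function is; on the obstacle surface F_OA is the tangential field itself.\<close>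

lemma F_nth [simp]:
  "F p $ 1 = (p$1)\<^sup>2 - (p$2)\<^sup>2 - (p$3)\<^sup>2" "F p $ 2 = 2 * p$1 * p$2" "F p $ 3 = 2 * p$1 * p$3"
  by (simp_all add: F_def Let_def)

lemma G_nth [simp]:
  "G p $ 1 = 2 * p$1 * ((p$2)\<^sup>2 + (p$3)\<^sup>2)"
  "G p $ 2 = p$2 * ((p$2)\<^sup>2 + (p$3)\<^sup>2 - (p$1)\<^sup>2)"
  "G p $ 3 = p$3 * ((p$2)\<^sup>2 + (p$3)\<^sup>2 - (p$1)\<^sup>2)"
  by (simp_all add: G_def Let_def)

lemma F_eq_0_iff: "F p = 0 \<longleftrightarrow> p = 0"
proof (cases "p$1 = 0")
  case True
  \<comment> \<open>The left side is the form to which simp brings the vanishing of the first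
    component when \<open>p$1 = 0\<close>.\<close>
  have "- (p$2)\<^sup>2 = (p$3)\<^sup>2 \<longleftrightarrow> (p$2)\<^sup>2 + (p$3)\<^sup>2 = 0"
    by linarith
  then show ?thesis
    using True by (simp add: vec_eq_iff forall_3 sum_power2_eq_zero_iff)
next
  case False
  then show ?thesis by (auto simp: vec_eq_iff forall_3)
qed

text \<open>Off the x-axis y^2 + z^2 > 0, so the first component forces x = 0; the other two are
  then positive multiples of y and z.\<close>

lemma G_eq_0_iff: "G p = 0 \<longleftrightarrow> p$2 = 0 \<and> p$3 = 0"
proof (cases "(p$2)\<^sup>2 + (p$3)\<^sup>2 = 0")
  case True
  then have "p$2 = 0" "p$3 = 0"
    by (simp_all add: sum_power2_eq_zero_iff)
  then show ?thesis by (simp add: vec_eq_iff forall_3)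
next
  case False
  then show ?thesis by (cases "p$1 = 0") (auto simp: vec_eq_iff forall_3)
qed

lemma orthogonal_G_F: "G p \<bullet> F p = 0"
  by (simp add: inner_vec_def sum_3 power2_eq_square algebra_simps)

lemma cross3_cross3_inner_left: "((n \<times> v) \<times> n) \<bullet> n = 0"
  by (simp add: dot_cross_self)

text \<open>Cyclic invariance of the scalar triple product.\<close>

lemma cross3_cross3_inner_right: "((n \<times> v) \<times> n) \<bullet> v = (norm (n \<times> v))\<^sup>2"
  by (metis cross_triple inner_commute power2_norm_eq_inner)

lemma tangential_inner_grad:
  assumes "p \<noteq> 0"
  shows "tangential \<Upsilon> p \<bullet> grad \<Upsilon> p = 0"
proof (cases "collinear {0, grad \<Upsilon> p, F p}")
  case True
  \<comment> \<open>With the nonzero vector \<open>F p\<close> first, \<open>collinear_lemma\<close>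
    yields the gradient as a multiple of it, possibly zero.\<close>
  then have "collinear {0, F p, grad \<Upsilon> p}"
    by (simp add: insert_commute)
  then obtain k where "grad \<Upsilon> p = k *\<^sub>R F p"
    using assms F_eq_0_iff[of p] by (auto simp: collinear_lemma)
  then show ?thesis
    using True by (simp add: tangential_def orthogonal_G_F)
next
  case False
  then show ?thesis
    by (simp add: tangential_def Let_def cross3_cross3_inner_left)
qed

text \<open>One formula serves both branches: in the collinear one, both sides are 0.\<close>

lemma tangential_inner_F:
  "tangential \<Upsilon> p \<bullet> F p = (norm (grad \<Upsilon> p \<times> F p))\<^sup>2"
  by (simp add: tangential_def Let_def orthogonal_G_F cross3_cross3_inner_right cross_eq_0)

lemma tangential_eq_0_iff:
  "tangential \<Upsilon> p = 0 \<longleftrightarrow> p$2 = 0 \<and> p$3 = 0 \<and> collinear {0, grad \<Upsilon> p, F p}"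
proof (cases "collinear {0, grad \<Upsilon> p, F p}")
  case True
  then show ?thesis by (simp add: tangential_def G_eq_0_iff)
next
  case False
  then have "tangential \<Upsilon> p \<bullet> F p \<noteq> 0"
    by (simp add: tangential_inner_F cross_eq_0)
  then show ?thesis using False by auto
qed

lemma F_OA_neq_0:
  assumes "p \<noteq> 0" "0 < \<psi> p" "\<psi> p \<le> 1"
  shows "F_OA \<Upsilon> \<psi> p \<noteq> 0"
proof -
  have "0 < \<psi> p * (norm (F p))\<^sup>2 + (1 - \<psi> p) * (norm (grad \<Upsilon> p \<times> F p))\<^sup>2"
    using assms by (intro add_pos_nonneg) (simp_all add: F_eq_0_iff)
  also have "\<dots> = F_OA \<Upsilon> \<psi> p \<bullet> F p"
    by (simp add: F_OA_def inner_add_left tangential_inner_F power2_norm_eq_inner)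
  finally show ?thesis by auto
qed

text \<open>The exception in the second claim is forced: at the excluded points \<open>F_OA\<close>
  is zero, by \<open>F_OA_eq_0_on_axis\<close>.\<close>

theorem theorem3:
  fixes \<Upsilon> \<psi> :: "real^3 \<Rightarrow> real" and po :: "real^3" and c :: real
  assumes "c > 1"
    and "C1 \<Upsilon>"
    and "\<And>v. mono_on {0..} (\<lambda>t. \<Upsilon> (po + t *\<^sub>R v))"
    and "\<And>k. 0 < k \<Longrightarrow> k \<in> range \<Upsilon> \<Longrightarrow> inside {p. \<Upsilon> p = k} \<noteq> {}"
    and "compact (reactive_area \<Upsilon> c)"
    and "0 \<notin> obstacle_area \<Upsilon> \<union> reactive_area \<Upsilon> c"
    and "smooth \<psi>"
    and "\<And>p. \<Upsilon> p \<le> 1 \<Longrightarrow> \<psi> p = 0"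
    and "\<And>p. c \<le> \<Upsilon> p \<Longrightarrow> \<psi> p = 1"
    and "\<And>p. 1 < \<Upsilon> p \<Longrightarrow> \<Upsilon> p < c \<Longrightarrow> 0 < \<psi> p \<and> \<psi> p < 1"
  shows "(\<forall>p. \<Upsilon> p = 1 \<longrightarrow> F_OA \<Upsilon> \<psi> p \<bullet> grad \<Upsilon> p = 0) \<and>
    (\<forall>p \<in> reactive_area \<Upsilon> c.
       \<not> (\<Upsilon> p = 1 \<and> p$2 = 0 \<and> p$3 = 0 \<and> collinear {0, grad \<Upsilon> p, F p}) \<longrightarrow>
       F_OA \<Upsilon> \<psi> p \<noteq> 0)"
proof (intro conjI allI ballI impI)
  fix p assume p: "\<Upsilon> p = 1"
  then have "p \<noteq> 0"
    \<comment> \<open>Since \<open>c > 1\<close>, the obstacle surface lies in the reactive area,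
      which avoids the origin.\<close>
    using assms(1,6) by (auto simp: reactive_area_def)
  then show "F_OA \<Upsilon> \<psi> p \<bullet> grad \<Upsilon> p = 0"
    using assms(8) p by (simp add: F_OA_def tangential_inner_grad)
next
  fix p
  assume p: "p \<in> reactive_area \<Upsilon> c"
    and ex: "\<not> (\<Upsilon> p = 1 \<and> p$2 = 0 \<and> p$3 = 0 \<and> collinear {0, grad \<Upsilon> p, F p})"
  show "F_OA \<Upsilon> \<psi> p \<noteq> 0"
  proof (cases "\<Upsilon> p = 1")
    case True
    then show ?thesis
      \<comment> \<open>Here \<open>\<psi> p = 0\<close>, and the excluded points are exactly the
        zeros of the tangential field on the surface.\<close>
      using assms(8) ex by (simp add: F_OA_def tangential_eq_0_iff)
  next
    case False
    then have "0 < \<psi> p \<and> \<psi> p \<le> 1"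
      \<comment> \<open>The outer boundary, where \<open>\<psi> p = 1\<close>, is split off because
        the strict bounds hold only inside.\<close>
      using assms(9,10)[of p] p by (cases "\<Upsilon> p = c") (auto simp: reactive_area_def)
    moreover have "p \<noteq> 0"
      using assms(6) p by auto
    ultimately show ?thesis by (simp add: F_OA_neq_0)
  qed
qed

end
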